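(* Let $X$ be a locally compact topometric space. Then $X$ is CB-analysable if and only if for no $\varepsilon>0$ is there an $\varepsilon$-perfect tree in $X$.
   Context: A topometric space is a triple $(X,\mathscr{T},d)$ where $\mathscr{T}$ is a topology on $X$ and $d\colon X^2\to[0,\infty]$ is a metric (infinite distances allowed) such that (1) $d$ refines the topology: for every open $U$ and $x\in U$ there is $r>0$ with $\{y: d(x,y)<r\}\subseteq U$; (2) $d$ is lower semi-continuous: for every real $r\ge 0$ the set $\{(a,b): d(a,b)\le r\}$ is closed in $X^2$. Topological terms (open, compact, locally compact) refer to $\mathscr{T}$. Distances between sets: $d(A,B)=\inf\{d(x,y):x\in A,y\in B\}$. For $\varepsilon>0$ let $X'_{d,\varepsilon}=X\setminus\bigcup\{U\subseteq X\text{ open}: \mathrm{diam}(U)\le\varepsilon\}$; let $X^{(0)}_{d,\varepsilon}=X$, $X^{(\alpha+1)}_{d,\varepsilon}=(X^{(\alpha)}_{d,\varepsilon})'_{d,\varepsilon}$ (computed in the subspace with induced structure), and take intersections at limit ordinals. $X$ is CB-analysable if $\bigcap_\alpha X^{(\alpha)}_{d,\varepsilon}=\varnothing$ for every $\varepsilon>0$. (Using "open and $\varepsilon$-finite" or "open and $\varepsilon$-bounded" sets in place of open sets of diameter $\le\varepsilon$ gives an equivalent notion.) An $\varepsilon$-perfect tree in $X$ is a family of non-empty compact sets $\{F_\sigma:\sigma\in 2^{<\omega}\}$ in $X$ such that $F_\tau\subseteq F_\sigma$ whenever $\tau$ extends $\sigma$, and $d(F_{\sigma0},F_{\sigma1})>\varepsilon$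 for all $\sigma\in 2^{<\omega}$. *)

theory Defs
  imports "HOL-Analysis.Analysis" "HOL-Library.Sublist"
begin

section \<open>Topometric spaces\<close>

definition extended_metric_on :: "'a set \<Rightarrow> ('a \<Rightarrow> 'a \<Rightarrow> ennreal) \<Rightarrow> bool" where
  "extended_metric_on S d \<longleftrightarrow>
     (\<forall>x\<in>S. \<forall>y\<in>S. d x y = 0 \<longleftrightarrow> x = y) \<and>
     (\<forall>x\<in>S. \<forall>y\<in>S. d x y = d y x) \<and>
     (\<forall>x\<in>S. \<forall>y\<in>S. \<forall>z\<in>S. d x z \<le> d x y + d y z)"

definition topometric_space :: "'a topology \<Rightarrow> ('a \<Rightarrow> 'a \<Rightarrow> ennreal) \<Rightarrow> bool" where
  "topometric_space X d \<longleftrightarrow>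
     extended_metric_on (topspace X) d \<and>
     (\<forall>U x. openin X U \<and> x \<in> U \<longrightarrow>
        (\<exists>r::real. r > 0 \<and> {y \<in> topspace X. d x y < ennreal r} \<subseteq> U)) \<and>
     (\<forall>r::real. r \<ge> 0 \<longrightarrow>
        closedin (prod_topology X X)
          {(a, b). a \<in> topspace X \<and> b \<in> topspace X \<and> d a b \<le> ennreal r})"

definition ext_diameter :: "('a \<Rightarrow> 'a \<Rightarrow> ennreal) \<Rightarrow> 'a set \<Rightarrow> ennreal" where
  "ext_diameter d A = (SUP x\<in>A. SUP y\<in>A. d x y)"

definition ext_setdist :: "('a \<Rightarrow> 'a \<Rightarrow> ennreal) \<Rightarrow> 'a set \<Rightarrow> 'a set \<Rightarrow> ennreal" where
  "ext_setdist d A B = (INF x\<in>A. INF y\<in>B. d x y)"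


section \<open>Transfinite Cantor-Bendixson derivatives\<close>

definition cb_deriv ::
  "'a topology \<Rightarrow> ('a \<Rightarrow> 'a \<Rightarrow> ennreal) \<Rightarrow> real \<Rightarrow> 'a set \<Rightarrow> 'a set" where
  "cb_deriv X d \<epsilon> A =
     A - \<Union>{U. openin (subtopology X A) U \<and> ext_diameter d U \<le> ennreal \<epsilon>}"

text \<open>Ordinals are represented by the elements of the field of a well-order \<open>r\<close>: the element
  \<open>\<alpha>\<close> stands for the order type of \<open>underS r \<alpha>\<close>, and it is the successor of \<open>\<beta>\<close> iff
  \<open>underS r \<alpha> = under r \<beta>\<close> with \<open>\<beta>\<close> strictly below \<open>\<alpha>\<close>.\<close>

definition is_succ_of :: "'o rel \<Rightarrow> 'o \<Rightarrow> 'o \<Rightarrow> bool" where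
  "is_succ_of r \<beta> \<alpha> \<longleftrightarrow> \<beta> \<in> underS r \<alpha> \<and> underS r \<alpha> = under r \<beta>"

definition cb_iter ::
  "'o rel \<Rightarrow> 'a topology \<Rightarrow> ('a \<Rightarrow> 'a \<Rightarrow> ennreal) \<Rightarrow> real \<Rightarrow> 'o \<Rightarrow> 'a set" where
  "cb_iter r X d \<epsilon> = wo_rel.worec r (\<lambda>F \<alpha>.
     if underS r \<alpha> = {} then topspace X
     else if \<exists>\<beta>. is_succ_of r \<beta> \<alpha> then cb_deriv X d \<epsilon> (F (THE \<beta>. is_succ_of r \<beta> \<alpha>))
     else (\<Inter>\<beta>\<in>underS r \<alpha>. F \<beta>))"

text \<open>The intersection over all ordinals is taken over the ordinals below the cardinal successor
  of the underlying type.  This is no restriction: by \<open>cb_kernel_subset_iter\<close> below, further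
  iteration, along any well-order on any type, never removes another point.\<close>

definition cb_kernel :: "'a topology \<Rightarrow> ('a \<Rightarrow> 'a \<Rightarrow> ennreal) \<Rightarrow> real \<Rightarrow> 'a set" where
  "cb_kernel X d \<epsilon> =
     (\<Inter>\<alpha>\<in>Field (cardSuc (card_of (UNIV :: 'a set))).
        cb_iter (cardSuc (card_of (UNIV :: 'a set))) X d \<epsilon> \<alpha>)"

definition CB_analysable :: "'a topology \<Rightarrow> ('a \<Rightarrow> 'a \<Rightarrow> ennreal) \<Rightarrow> bool" where
  "CB_analysable X d \<longleftrightarrow> (\<forall>\<epsilon>::real. \<epsilon> > 0 \<longrightarrow> cb_kernel X d \<epsilon> = {})"


section \<open>Perfect trees\<close>

text \<open>The nodes \<open>\<sigma>0\<close> and \<open>\<sigma>1\<close> are \<open>\<sigma> @ [False]\<close> and \<open>\<sigma> @ [True]\<close>.\<close>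

definition perfect_tree ::
  "'a topology \<Rightarrow> ('a \<Rightarrow> 'a \<Rightarrow> ennreal) \<Rightarrow> real \<Rightarrow> (bool list \<Rightarrow> 'a set) \<Rightarrow> bool" where
  "perfect_tree X d \<epsilon> F \<longleftrightarrow>
     (\<forall>\<sigma>. F \<sigma> \<noteq> {} \<and> compactin X (F \<sigma>)) \<and>
     (\<forall>\<sigma> \<tau>. prefix \<sigma> \<tau> \<longrightarrow> F \<tau> \<subseteq> F \<sigma>) \<and>
     (\<forall>\<sigma>. ext_setdist d (F (\<sigma> @ [False])) (F (\<sigma> @ [True])) > ennreal \<epsilon>)"


section \<open>Correctness of the transfinite iteration\<close>

lemma cb_deriv_subset: "cb_deriv X d \<epsilon> A \<subseteq> A"
  by (auto simp: cb_deriv_def)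

lemma ext_diameter_mono: "A \<subseteq> B \<Longrightarrow> ext_diameter d A \<le> ext_diameter d B"
  unfolding ext_diameter_def by (intro SUP_subset_mono) auto

lemma cb_deriv_mono:
  assumes "A \<subseteq> B"
  shows "cb_deriv X d \<epsilon> A \<subseteq> cb_deriv X d \<epsilon> B"
proof
  fix x assume x: "x \<in> cb_deriv X d \<epsilon> A"
  have "x \<notin> U" if U: "openin (subtopology X B) U" "ext_diameter d U \<le> ennreal \<epsilon>" for U
  proof
    assume "x \<in> U"
    have "openin (subtopology X A) (U \<inter> A)"
      using U(1) assms by (auto simp: openin_subtopology)
    moreover have "ext_diameter d (U \<inter> A) \<le> ennreal \<epsilon>"
      using ext_diameter_mono[of "U \<inter> A" U d] U(2) by auto
    ultimately show False
      using x \<open>x \<in> U\<close> by (auto simp: cb_deriv_def)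
  qed
  then show "x \<in> cb_deriv X d \<epsilon> B"
    using x assms by (auto simp: cb_deriv_def)
qed

lemma is_succ_of_unique:
  assumes "Well_order r" "is_succ_of r \<beta> \<alpha>" "is_succ_of r \<gamma> \<alpha>"
  shows "\<beta> = \<gamma>"
proof -
  have "antisym r" using assms(1) by (simp add: wo_rel.ANTISYM wo_rel_def)
  moreover have "(\<beta>, \<gamma>) \<in> r" "(\<gamma>, \<beta>) \<in> r"
    using assms(2,3) by (auto simp: is_succ_of_def under_def)
  ultimately show ?thesis by (auto dest: antisymD)
qed

lemma is_succ_of_THE:
  "Well_order r \<Longrightarrow> is_succ_of r \<beta> \<alpha> \<Longrightarrow> (THE \<beta>. is_succ_of r \<beta> \<alpha>) = \<beta>"
  by (rule the_equality) (auto intro: is_succ_of_unique)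

lemma cb_iter_unfold:
  assumes r: "Well_order r"
  shows "cb_iter r X d \<epsilon> \<alpha> =
     (if underS r \<alpha> = {} then topspace X
      else if \<exists>\<beta>. is_succ_of r \<beta> \<alpha>
           then cb_deriv X d \<epsilon> (cb_iter r X d \<epsilon> (THE \<beta>. is_succ_of r \<beta> \<alpha>))
      else (\<Inter>\<beta>\<in>underS r \<alpha>. cb_iter r X d \<epsilon> \<beta>))"
proof -
  let ?H = "\<lambda>F \<alpha>. if underS r \<alpha> = {} then topspace X
     else if \<exists>\<beta>. is_succ_of r \<beta> \<alpha> then cb_deriv X d \<epsilon> (F (THE \<beta>. is_succ_of r \<beta> \<alpha>))
     else (\<Inter>\<beta>\<in>underS r \<alpha>. F \<beta>)"
  have wo: "wo_rel r" using r by (simp add: wo_rel_def)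
  have "wo_rel.adm_wo r ?H"
    unfolding wo_rel.adm_wo_def[OF wo]
  proof (intro allI impI)
    fix f g :: "'a \<Rightarrow> 'b set" and x
    assume fg: "\<forall>y\<in>underS r x. f y = g y"
    have "f (THE \<beta>. is_succ_of r \<beta> x) = g (THE \<beta>. is_succ_of r \<beta> x)" if "is_succ_of r \<beta> x" for \<beta>
      unfolding is_succ_of_THE[OF r that] using that fg unfolding is_succ_of_def by blast
    then show "?H f x = ?H g x" using fg by auto
  qed
  from wo_rel.worec_fixpoint[OF wo this]
  show ?thesis unfolding cb_iter_def by (rule fun_cong)
qed

lemma cb_iter_zero:
  "Well_order r \<Longrightarrow> underS r \<alpha> = {} \<Longrightarrow> cb_iter r X d \<epsilon> \<alpha> = topspace X"
  by (subst cb_iter_unfold) auto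

lemma cb_iter_succ:
  assumes "Well_order r" "is_succ_of r \<beta> \<alpha>"
  shows "cb_iter r X d \<epsilon> \<alpha> = cb_deriv X d \<epsilon> (cb_iter r X d \<epsilon> \<beta>)"
proof -
  have "underS r \<alpha> \<noteq> {}" using assms(2) by (auto simp: is_succ_of_def)
  then show ?thesis
    using assms by (subst cb_iter_unfold) (auto simp: is_succ_of_THE)
qed

lemma cb_iter_limit:
  "Well_order r \<Longrightarrow> underS r \<alpha> \<noteq> {} \<Longrightarrow> \<nexists>\<beta>. is_succ_of r \<beta> \<alpha> \<Longrightarrow>
     cb_iter r X d \<epsilon> \<alpha> = (\<Inter>\<beta>\<in>underS r \<alpha>. cb_iter r X d \<epsilon> \<beta>)"
  by (subst cb_iter_unfold) auto

lemma cb_iter_subset_topspace: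
  assumes r: "Well_order r"
  shows "cb_iter r X d \<epsilon> \<alpha> \<subseteq> topspace X"
proof (induction \<alpha> rule: wo_rel.well_order_induct[of r])
  case 1 show ?case using r by (simp add: wo_rel_def)
next
  case (2 x)
  then have IH: "cb_iter r X d \<epsilon> y \<subseteq> topspace X" if "y \<in> underS r x" for y
    using that by (auto simp: underS_def)
  consider "underS r x = {}" | \<beta> where "is_succ_of r \<beta> x"
    | "underS r x \<noteq> {}" "\<nexists>\<beta>. is_succ_of r \<beta> x" by blast
  then show ?case
  proof cases
    case 1 then show ?thesis by (simp add: cb_iter_zero[OF r])
  next
    case 2
    then show ?thesis
      using IH[of \<beta>] cb_deriv_subset[of X d \<epsilon>] cb_iter_succ[OF r 2, of X d \<epsilon>]
      by (auto simp: is_succ_of_def)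
  next
    case 3 then show ?thesis using IH by (auto simp: cb_iter_limit[OF r 3])
  qed
qed

lemma cb_iter_less:
  assumes r: "Well_order r" and "\<alpha> \<in> underS r \<gamma>"
  shows "cb_iter r X d \<epsilon> \<gamma> \<subseteq> cb_deriv X d \<epsilon> (cb_iter r X d \<epsilon> \<alpha>)"
  using assms(2)
proof (induction \<gamma> rule: wo_rel.well_order_induct[of r])
  case 1 show ?case using r by (simp add: wo_rel_def)
next
  case (2 x)
  have wo: "wo_rel r" using r by (simp add: wo_rel_def)
  from 2 have IH: "cb_iter r X d \<epsilon> y \<subseteq> cb_deriv X d \<epsilon> (cb_iter r X d \<epsilon> \<alpha>)"
    if "y \<in> underS r x" "\<alpha> \<in> underS r y" for y
    using that by (auto simp: underS_def)
  show ?case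
  proof (cases "\<exists>\<beta>. is_succ_of r \<beta> x")
    case True
    then obtain \<beta> where \<beta>: "is_succ_of r \<beta> x" by blast
    show ?thesis
    proof (cases "\<alpha> = \<beta>")
      case True then show ?thesis using cb_iter_succ[OF r \<beta>, of X d \<epsilon>] by simp
    next
      case False
      then have "\<alpha> \<in> underS r \<beta>"
        using 2(2) \<beta> by (auto simp: is_succ_of_def under_def underS_def)
      then have "cb_iter r X d \<epsilon> \<beta> \<subseteq> cb_deriv X d \<epsilon> (cb_iter r X d \<epsilon> \<alpha>)"
        using IH[of \<beta>] \<beta> by (auto simp: is_succ_of_def)
      then show ?thesis
        using cb_iter_succ[OF r \<beta>, of X d \<epsilon>] cb_deriv_subset[of X d \<epsilon> "cb_iter r X d \<epsilon> \<beta>"] by auto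
    qed
  next
    case False
    then have "underS r x \<noteq> under r \<alpha>" using 2(2) by (auto simp: is_succ_of_def)
    moreover have "under r \<alpha> \<subseteq> underS r x"
      using 2(2) wo_rel.TRANS[OF wo] wo_rel.ANTISYM[OF wo]
      by (auto simp: under_def underS_def dest: transD antisymD)
    ultimately obtain c where c: "c \<in> underS r x" "c \<notin> under r \<alpha>" by blast
    have "\<alpha> \<in> Field r" "c \<in> Field r"
      using 2(2) c(1) by (auto simp: underS_def Field_def)
    then have "\<alpha> \<in> underS r c"
      using c(2) wo_rel.TOTALS[OF wo] by (auto simp: under_def underS_def)
    then have "cb_iter r X d \<epsilon> c \<subseteq> cb_deriv X d \<epsilon> (cb_iter r X d \<epsilon> \<alpha>)"
      using IH c(1) by blast
    moreover have "cb_iter r X d \<epsilon> x \<subseteq> cb_iter r X d \<epsilon> c"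
    proof -
      have "underS r x \<noteq> {}" using c(1) by blast
      from cb_iter_limit[OF r this False, of X d \<epsilon>] show ?thesis using c(1) by blast
    qed
    ultimately show ?thesis by blast
  qed
qed

lemma fixed_subset_cb_iter:
  assumes r: "Well_order r" and P: "P \<subseteq> topspace X" "cb_deriv X d \<epsilon> P = P"
  shows "P \<subseteq> cb_iter r X d \<epsilon> \<alpha>"
proof (induction \<alpha> rule: wo_rel.well_order_induct[of r])
  case 1 show ?case using r by (simp add: wo_rel_def)
next
  case (2 x)
  then have IH: "P \<subseteq> cb_iter r X d \<epsilon> y" if "y \<in> underS r x" for y
    using that by (auto simp: underS_def)
  consider "underS r x = {}" | \<beta> where "is_succ_of r \<beta> x"
    | "underS r x \<noteq> {}" "\<nexists>\<beta>. is_succ_of r \<beta> x" by blast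
  then show ?case
  proof cases
    case 1 then show ?thesis using P by (simp add: cb_iter_zero[OF r])
  next
    case 2
    then have "P \<subseteq> cb_iter r X d \<epsilon> \<beta>" using IH by (auto simp: is_succ_of_def)
    then show ?thesis
      using cb_deriv_mono[of P _ X d \<epsilon>] P(2) cb_iter_succ[OF r 2] by metis
  next
    case 3 then show ?thesis using IH by (auto simp: cb_iter_limit[OF r 3])
  qed
qed

lemma cb_kernel_stage:
  fixes X :: "'a topology"
  shows "\<exists>\<alpha>. cb_kernel X d \<epsilon> = cb_iter (cardSuc (card_of (UNIV :: 'a set))) X d \<epsilon> \<alpha> \<and>
    cb_deriv X d \<epsilon> (cb_kernel X d \<epsilon>) = cb_kernel X d \<epsilon>"
proof -
  define r where "r = cardSuc (card_of (UNIV :: 'a set))"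
  have co: "Card_order r" and less: "(card_of (UNIV :: 'a set), r) \<in> ordLess"
    unfolding r_def by (simp_all add: cardSuc_Card_order cardSuc_greater card_of_Card_order)
  have r: "Well_order r" using co by (rule card_order_on_well_order_on)
  then have wo: "wo_rel r" by (simp add: wo_rel_def)
  let ?Z = "cb_iter r X d \<epsilon>"
  have "\<exists>\<alpha>\<in>Field r. cb_deriv X d \<epsilon> (?Z \<alpha>) = ?Z \<alpha>"
  proof (rule ccontr)
    assume "\<not> ?thesis"
    then have "\<forall>\<alpha>\<in>Field r. \<exists>x. x \<in> ?Z \<alpha> - cb_deriv X d \<epsilon> (?Z \<alpha>)"
      using cb_deriv_subset by fastforce
    then obtain p where p: "\<And>\<alpha>. \<alpha> \<in> Field r \<Longrightarrow> p \<alpha> \<in> ?Z \<alpha> - cb_deriv X d \<epsilon> (?Z \<alpha>)"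
      by metis
    have ne: "p a \<noteq> p b" if "a \<in> underS r b" "a \<in> Field r" "b \<in> Field r" for a b
      using cb_iter_less[OF r that(1), of X d \<epsilon>] p[OF that(2)] p[OF that(3)] by auto
    have "inj_on p (Field r)"
    proof (rule inj_onI, rule ccontr)
      fix a b assume ab: "a \<in> Field r" "b \<in> Field r" "p a = p b" "a \<noteq> b"
      then have "a \<in> underS r b \<or> b \<in> underS r a"
        using wo_rel.TOTALS[OF wo] by (auto simp: underS_def)
      then show False using ne ab by metis
    qed
    then have "(card_of (Field r), card_of (UNIV :: 'a set)) \<in> ordLeq"
      using card_of_ordLeqI[of p "Field r" UNIV] by auto
    then have "(r, card_of (UNIV :: 'a set)) \<in> ordLeq"
      using card_of_Field_ordIso[OF co] ordIso_ordLeq_trans ordIso_symmetric by blast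
    then show False using less not_ordLess_ordLeq by blast
  qed
  then obtain \<alpha> where \<alpha>: "\<alpha> \<in> Field r" "cb_deriv X d \<epsilon> (?Z \<alpha>) = ?Z \<alpha>" by blast
  have "cb_kernel X d \<epsilon> = ?Z \<alpha>"
    unfolding cb_kernel_def r_def[symmetric]
    using \<alpha>(1) fixed_subset_cb_iter[OF r cb_iter_subset_topspace[OF r] \<alpha>(2)] by blast
  then show ?thesis using \<alpha>(2) unfolding r_def by metis
qed

lemma cb_kernel_subset_iter:
  assumes "Well_order s"
  shows "cb_kernel X d \<epsilon> \<subseteq> cb_iter s X d \<epsilon> \<alpha>"
proof -
  have "cb_kernel X d \<epsilon> \<subseteq> topspace X"
    using cb_kernel_stage[of X d \<epsilon>] cb_iter_subset_topspace
      card_order_on_well_order_on[OF cardSuc_Card_order[OF card_of_Card_order]]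
    by metis
  then show ?thesis
    using fixed_subset_cb_iter[OF assms] cb_kernel_stage[of X d \<epsilon>] by metis
qed

end

theory Submission
  imports Defs
begin

text \<open>
  The kernel \<open>\<Inter>\<^sub>\<alpha> X\<^sup>(\<^sup>\<alpha>\<^sup>)\<close> at \<open>\<epsilon>\<close> is the largest set of points fixed by the derivative, and a set \<open>P\<close> is
  fixed exactly if every open set that meets \<open>P\<close> contains two points of \<open>P\<close> at distance more than
  \<open>\<epsilon>\<close>. So for one and the same \<open>\<epsilon>\<close> it is enough to turn a non-empty fixed set into an
  \<open>\<epsilon>\<close>-perfect tree and conversely; all ordinals disappear from the argument.

  From a fixed set \<open>P\<close> to a tree (\<open>fixed_set_imp_perfect_tree\<close>): every node is a compact set
  containing an open set that meets \<open>P\<close>. That open set contains two points of \<open>P\<close> at distance more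
  than \<open>\<epsilon>\<close>; lower semi-continuity of \<open>d\<close> keeps neighbourhoods of them more than \<open>\<epsilon>\<close> apart, and
  local compactness, in a space which is Hausdorff because \<open>d\<close> is lower semi-continuous, puts the
  two children into these neighbourhoods.

  From a tree \<open>F\<close> to a fixed set (\<open>perfect_tree_imp_fixed_set\<close>): take \<open>P\<close> minimal among the closed
  sets that meet every node. Removing from \<open>P\<close> an open set \<open>U\<close> that meets \<open>P\<close> leaves a smaller
  closed set, which therefore misses some node \<open>F \<sigma>\<close>; then \<open>P \<inter> F \<sigma> \<subseteq> U\<close>. Since \<open>P\<close> meets both
  children of \<open>\<sigma>\<close>, which are more than \<open>\<epsilon>\<close> apart, \<open>U \<inter> P\<close> has diameter more than \<open>\<epsilon>\<close>. Thus \<open>P\<close> is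
  fixed.
\<close>

lemma cb_deriv_eq_iff:
  "cb_deriv X d \<epsilon> A = A \<longleftrightarrow>
    (\<forall>U. openin X U \<and> U \<inter> A \<noteq> {} \<longrightarrow> (\<exists>x\<in>U \<inter> A. \<exists>y\<in>U \<inter> A. ennreal \<epsilon> < d x y))"
proof -
  have "U \<subseteq> A" if "openin (subtopology X A) U" for U
    using openin_subset[OF that] by simp
  then have "cb_deriv X d \<epsilon> A = A \<longleftrightarrow>
    (\<forall>U. openin (subtopology X A) U \<and> U \<noteq> {} \<longrightarrow> \<not> ext_diameter d U \<le> ennreal \<epsilon>)"
    unfolding cb_deriv_def by blast
  also have "\<dots> \<longleftrightarrow>
    (\<forall>U. openin X U \<and> U \<inter> A \<noteq> {} \<longrightarrow> \<not> ext_diameter d (U \<inter> A) \<le> ennreal \<epsilon>)"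
    by (auto simp: openin_subtopology)
  finally show ?thesis
    by (simp add: ext_diameter_def SUP_le_iff not_le)
qed

text \<open>The iteration becomes stationary at the kernel, so the kernel itself is fixed; on the other
  hand a fixed set loses no point at any stage.\<close>

lemma cb_kernel_nonempty_iff:
  "cb_kernel X d \<epsilon> \<noteq> {} \<longleftrightarrow>
    (\<exists>P. P \<subseteq> topspace X \<and> P \<noteq> {} \<and> cb_deriv X d \<epsilon> P = P)"
proof
  assume "cb_kernel X d \<epsilon> \<noteq> {}"
  moreover have "cb_kernel X d \<epsilon> \<subseteq> topspace X"
    using cb_kernel_stage[of X d \<epsilon>] cb_iter_subset_topspace
      card_order_on_well_order_on[OF cardSuc_Card_order[OF card_of_Card_order]] by metis
  ultimately show "\<exists>P. P \<subseteq> topspace X \<and> P \<noteq> {} \<and> cb_deriv X d \<epsilon> P = P"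
    using cb_kernel_stage[of X d \<epsilon>] by metis
next
  assume "\<exists>P. P \<subseteq> topspace X \<and> P \<noteq> {} \<and> cb_deriv X d \<epsilon> P = P"
  then obtain P where P: "P \<subseteq> topspace X" "P \<noteq> {}" "cb_deriv X d \<epsilon> P = P" by blast
  have "P \<subseteq> cb_kernel X d \<epsilon>"
    unfolding cb_kernel_def
    using fixed_subset_cb_iter[OF card_order_on_well_order_on
        [OF cardSuc_Card_order[OF card_of_Card_order]] P(1,3)]
    by blast
  then show "cb_kernel X d \<epsilon> \<noteq> {}" using P(2) by blast
qed

text \<open>If a compact set lies in the union of a chain of open sets, then it already lies in one
  member of the chain; hence Zorn's lemma applies. The complement of \<open>W\<close> is a minimal closed set
  meeting every \<open>F i\<close>.\<close>

lemma maximal_open_containing_none: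
  assumes cpt: "\<And>i. compactin X (F i)" and ne: "\<And>i. F i \<noteq> {}"
  shows "\<exists>W. openin X W \<and> (\<forall>i. \<not> F i \<subseteq> W) \<and>
    (\<forall>V. openin X V \<and> W \<subset> V \<longrightarrow> (\<exists>i. F i \<subseteq> V))"
proof -
  define \<A> where "\<A> = {W. openin X W \<and> (\<forall>i. \<not> F i \<subseteq> W)}"
  have "\<exists>M\<in>\<A>. \<forall>V\<in>\<A>. M \<subseteq> V \<longrightarrow> V = M"
  proof (rule subset_Zorn_nonempty)
    have "{} \<in> \<A>" using ne by (auto simp: \<A>_def)
    then show "\<A> \<noteq> {}" by blast
  next
    fix \<C> assume \<C>: "\<C> \<noteq> {}" "subset.chain \<A> \<C>"
    then have sub: "\<And>V. V \<in> \<C> \<Longrightarrow> V \<in> \<A>" by (auto simp: subset.chain_def)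
    have "\<not> F i \<subseteq> \<Union>\<C>" for i
    proof
      assume "F i \<subseteq> \<Union>\<C>"
      moreover have "openin X V" if "V \<in> \<C>" for V using sub[OF that] by (simp add: \<A>_def)
      ultimately obtain \<D> where "finite \<D>" "\<D> \<subseteq> \<C>" "F i \<subseteq> \<Union>\<D>"
        using compactinD[OF cpt[of i], of \<C>] by metis
      moreover have "\<D> \<noteq> {}" using \<open>F i \<subseteq> \<Union>\<D>\<close> ne[of i] by auto
      moreover have "subset.chain \<A> \<D>"
        using \<C>(2) \<open>\<D> \<subseteq> \<C>\<close> unfolding subset_chain_def by (meson subset_eq)
      ultimately have "\<Union>\<D> \<in> \<D>" using \<open>finite \<D>\<close> by (intro Union_in_chain)
      then have "\<Union>\<D> \<in> \<A>" using \<open>\<D> \<subseteq> \<C>\<close> sub by blast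
      then show False using \<open>F i \<subseteq> \<Union>\<D>\<close> unfolding \<A>_def by blast
    qed
    then show "\<Union>\<C> \<in> \<A>" using sub by (auto simp: \<A>_def)
  qed
  then obtain W where "W \<in> \<A>" "\<forall>V\<in>\<A>. W \<subseteq> V \<longrightarrow> V = W" by blast
  then show ?thesis unfolding \<A>_def by (intro exI[of _ W]) blast
qed

lemma less_ext_setdistD:
  "r < ext_setdist d A B \<Longrightarrow> x \<in> A \<Longrightarrow> y \<in> B \<Longrightarrow> r < d x y"
  unfolding ext_setdist_def by (meson INF_lower2 less_le_trans order_refl)

text \<open>A minimal closed set meeting every node is fixed: an open set that meets it must absorb its
  trace on a whole node, and hence contains points of it from both children of that node.\<close>

lemma perfect_tree_imp_fixed_set:
  assumes F: "perfect_tree X d \<epsilon> F"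
  shows "\<exists>P. P \<subseteq> topspace X \<and> P \<noteq> {} \<and> cb_deriv X d \<epsilon> P = P"
proof -
  have cpt: "compactin X (F \<sigma>)" and ne: "F \<sigma> \<noteq> {}"
    and mono: "prefix \<sigma> \<tau> \<Longrightarrow> F \<tau> \<subseteq> F \<sigma>"
    and far: "ennreal \<epsilon> < ext_setdist d (F (\<sigma> @ [False])) (F (\<sigma> @ [True]))" for \<sigma> \<tau>
    using F by (auto simp: perfect_tree_def)
  obtain W where W: "openin X W" "\<And>\<sigma>. \<not> F \<sigma> \<subseteq> W"
    and max: "\<And>V. openin X V \<Longrightarrow> W \<subset> V \<Longrightarrow> \<exists>\<sigma>. F \<sigma> \<subseteq> V"
    using maximal_open_containing_none[of X F, OF cpt ne] by metis
  define P where "P = topspace X - W"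
  have top: "F \<sigma> \<subseteq> topspace X" for \<sigma> using cpt by (rule compactin_subset_topspace)
  have "P \<subseteq> topspace X" unfolding P_def by blast
  moreover have "P \<noteq> {}" using W(2)[of "[]"] top[of "[]"] unfolding P_def by blast
  moreover have "cb_deriv X d \<epsilon> P = P"
    unfolding cb_deriv_eq_iff
  proof (intro allI impI, elim conjE)
    fix U assume U: "openin X U" "U \<inter> P \<noteq> {}"
    then have "W \<subset> W \<union> U" by (auto simp: P_def)
    then obtain \<sigma> where \<sigma>: "F \<sigma> \<subseteq> W \<union> U"
      using max[OF openin_Un[OF W(1) U(1)]] by blast
    obtain x y where x: "x \<in> F (\<sigma> @ [False])" "x \<notin> W" and y: "y \<in> F (\<sigma> @ [True])" "y \<notin> W"
      using W(2)[of "\<sigma> @ [False]"] W(2)[of "\<sigma> @ [True]"] by blast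
    have "x \<in> U \<inter> P" "y \<in> U \<inter> P"
      using x y \<sigma> mono[of \<sigma> "\<sigma> @ [False]"] mono[of \<sigma> "\<sigma> @ [True]"]
        top[of "\<sigma> @ [False]"] top[of "\<sigma> @ [True]"] by (auto simp: P_def)
    then show "\<exists>x\<in>U \<inter> P. \<exists>y\<in>U \<inter> P. ennreal \<epsilon> < d x y"
      using less_ext_setdistD[OF far x(1) y(1)] by blast
  qed
  ultimately show ?thesis by blast
qed

text \<open>The closed set in the semi-continuity axiom for \<open>r = 0\<close> is the diagonal.\<close>

lemma topometric_space_Hausdorff:
  assumes "topometric_space X d"
  shows "Hausdorff_space X"
proof -
  have "closedin (prod_topology X X)
      {(a, b). a \<in> topspace X \<and> b \<in> topspace X \<and> d a b \<le> ennreal 0}"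
    using assms unfolding topometric_space_def by blast
  also have "{(a, b). a \<in> topspace X \<and> b \<in> topspace X \<and> d a b \<le> ennreal 0} =
      (\<lambda>x. (x, x)) ` topspace X"
    using assms by (auto simp: topometric_space_def extended_metric_on_def)
  finally show ?thesis by (simp add: Hausdorff_space_closedin_diagonal)
qed

lemma separated_neighbourhoods:
  assumes X: "topometric_space X d" and xy: "x \<in> topspace X" "y \<in> topspace X"
    and "ennreal \<epsilon> < d x y"
  obtains A B where "openin X A" "openin X B" "x \<in> A" "y \<in> B"
    "ennreal \<epsilon> < ext_setdist d A B"
proof -
  \<comment> \<open>A value strictly between is needed: semi-continuity only gives \<open>r < d a b\<close> pointwise, hence
    \<open>r \<le> ext_setdist d A B\<close> for the infimum.\<close>
  obtain z where z: "ennreal \<epsilon> < z" "z < d x y" using dense[OF assms(4)] by blast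
  then obtain r where r: "z = ennreal r" "0 \<le> r"
    by (cases z) (auto simp: top.not_eq_extremum)
  define S where "S = {(a, b). a \<in> topspace X \<and> b \<in> topspace X \<and> d a b \<le> ennreal r}"
  have closed: "closedin (prod_topology X X) S"
    using X r(2) unfolding topometric_space_def S_def by blast
  define N where "N = topspace (prod_topology X X) - S"
  have "openin (prod_topology X X) N"
    unfolding N_def by (rule openin_diff[OF openin_topspace closed])
  moreover have "(x, y) \<in> N"
    using xy z(2) r by (auto simp: N_def S_def)
  ultimately obtain A B where AB: "openin X A" "openin X B" "x \<in> A" "y \<in> B"
    and sub: "A \<times> B \<subseteq> N"
    unfolding openin_prod_topology_alt by metis
  have "ennreal r \<le> d a b" if "a \<in> A" "b \<in> B" for a b
    using that sub openin_subset[OF AB(1)] openin_subset[OF AB(2)] by (force simp: N_def S_def)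
  then have "ennreal r \<le> ext_setdist d A B"
    unfolding ext_setdist_def by (auto intro!: INF_greatest)
  then show thesis using that[OF AB] z(1) r(1) by auto
qed

lemma ext_setdist_antimono:
  "A \<subseteq> A' \<Longrightarrow> B \<subseteq> B' \<Longrightarrow> ext_setdist d A' B' \<le> ext_setdist d A B"
  unfolding ext_setdist_def by (intro INF_superset_mono order_refl) auto

text \<open>The branching step of the tree. The open sets \<open>V0\<close> and \<open>V1\<close> record that the compact sets
  around them can be split again.\<close>

lemma split_neighbourhood:
  assumes X: "topometric_space X d" "locally_compact_space X"
    and fixed: "cb_deriv X d \<epsilon> P = P" and V: "openin X V" "V \<inter> P \<noteq> {}"
  obtains V0 C0 V1 C1 where
    "openin X V0" "V0 \<inter> P \<noteq> {}" "compactin X C0" "V0 \<subseteq> C0" "C0 \<subseteq> V"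
    "openin X V1" "V1 \<inter> P \<noteq> {}" "compactin X C1" "V1 \<subseteq> C1" "C1 \<subseteq> V"
    "ennreal \<epsilon> < ext_setdist d C0 C1"
proof -
  have nbhd: "neighbourhood_base_of (compactin X) X"
    using X(2) topometric_space_Hausdorff[OF X(1)]
    by (simp add: locally_compact_space_neighbourhood_base)
  obtain x y where xy: "x \<in> V" "y \<in> V" "x \<in> P" "y \<in> P" "ennreal \<epsilon> < d x y"
    using fixed V unfolding cb_deriv_eq_iff by blast
  moreover from xy have "x \<in> topspace X" "y \<in> topspace X"
    using openin_subset[OF V(1)] by auto
  ultimately obtain A B where AB: "openin X A" "openin X B" "x \<in> A" "y \<in> B"
    "ennreal \<epsilon> < ext_setdist d A B"
    using separated_neighbourhoods[OF X(1)] by metis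
  obtain V0 C0 where 0: "openin X V0" "compactin X C0" "x \<in> V0" "V0 \<subseteq> C0" "C0 \<subseteq> V \<inter> A"
    using nbhd openin_Int[OF V(1) AB(1)] xy AB unfolding neighbourhood_base_of by (metis IntI)
  obtain V1 C1 where 1: "openin X V1" "compactin X C1" "y \<in> V1" "V1 \<subseteq> C1" "C1 \<subseteq> V \<inter> B"
    using nbhd openin_Int[OF V(1) AB(2)] xy AB unfolding neighbourhood_base_of by (metis IntI)
  have "ext_setdist d A B \<le> ext_setdist d C0 C1"
    using 0 1 by (intro ext_setdist_antimono) auto
  then show thesis
    using that[of V0 C0 V1 C1] 0 1 xy AB(5) by (auto dest: less_le_trans)
qed

lemma fixed_set_imp_perfect_tree:
  assumes X: "topometric_space X d" "locally_compact_space X"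
    and P: "P \<subseteq> topspace X" "P \<noteq> {}" "cb_deriv X d \<epsilon> P = P"
  shows "\<exists>F. perfect_tree X d \<epsilon> F"
proof -
  define good where "good = (\<lambda>(V, C). openin X V \<and> V \<inter> P \<noteq> {} \<and> compactin X C \<and> V \<subseteq> C)"
  have "\<exists>q. \<forall>b. good (q b) \<and> snd (q b) \<subseteq> V \<and>
      ennreal \<epsilon> < ext_setdist d (snd (q False)) (snd (q True))"
    if V: "openin X V" "V \<inter> P \<noteq> {}" for V
  proof -
    obtain V0 C0 V1 C1 where
      "openin X V0" "V0 \<inter> P \<noteq> {}" "compactin X C0" "V0 \<subseteq> C0" "C0 \<subseteq> V"
      "openin X V1" "V1 \<inter> P \<noteq> {}" "compactin X C1" "V1 \<subseteq> C1" "C1 \<subseteq> V"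
      "ennreal \<epsilon> < ext_setdist d C0 C1"
      using split_neighbourhood[OF X P(3) V] .
    then show ?thesis
      by (intro exI[of _ "\<lambda>b. if b then (V1, C1) else (V0, C0)"]) (auto simp: good_def)
  qed
  then obtain q where q: "\<And>V b. openin X V \<Longrightarrow> V \<inter> P \<noteq> {} \<Longrightarrow> good (q V b)"
      "\<And>V b. openin X V \<Longrightarrow> V \<inter> P \<noteq> {} \<Longrightarrow> snd (q V b) \<subseteq> V"
      "\<And>V. openin X V \<Longrightarrow> V \<inter> P \<noteq> {} \<Longrightarrow>
        ennreal \<epsilon> < ext_setdist d (snd (q V False)) (snd (q V True))"
    by metis
  \<comment> \<open>Children extend a node at the end of the list, hence recursion by \<open>foldl\<close>.\<close>
  define G where "G = foldl (\<lambda>p b. q (fst p) b) (q (topspace X) False)"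
  have root: "G [] = q (topspace X) False" and child: "G (\<sigma> @ [b]) = q (fst (G \<sigma>)) b" for \<sigma> b
    by (simp_all add: G_def)
  have good: "good (G \<sigma>)" for \<sigma>
  proof (induction \<sigma> rule: rev_induct)
    case Nil
    have "topspace X \<inter> P \<noteq> {}" using P(1,2) by blast
    then show ?case unfolding root by (intro q(1)) auto
  next
    case (snoc b \<sigma>)
    then show ?case unfolding child by (intro q(1)) (auto simp: good_def)
  qed
  have V: "openin X (fst (G \<sigma>))" "fst (G \<sigma>) \<inter> P \<noteq> {}" "compactin X (snd (G \<sigma>))"
    "fst (G \<sigma>) \<subseteq> snd (G \<sigma>)" for \<sigma>
    using good[of \<sigma>] by (auto simp: good_def)
  have mono: "snd (G (\<sigma> @ \<rho>)) \<subseteq> snd (G \<sigma>)" for \<sigma> \<rho>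
  proof (induction \<rho> rule: rev_induct)
    case (snoc b \<rho>)
    have "snd (G (\<sigma> @ \<rho> @ [b])) \<subseteq> fst (G (\<sigma> @ \<rho>))"
      using q(2)[OF V(1,2)] child[of "\<sigma> @ \<rho>" b] by simp
    then show ?case using V(4) snoc by blast
  qed simp
  have "perfect_tree X d \<epsilon> (\<lambda>\<sigma>. snd (G \<sigma>))"
    unfolding perfect_tree_def
  proof (intro conjI allI impI)
    show "snd (G \<sigma>) \<noteq> {}" for \<sigma> using V(2,4)[of \<sigma>] by blast
    show "compactin X (snd (G \<sigma>))" for \<sigma> by (rule V(3))
    show "snd (G \<tau>) \<subseteq> snd (G \<sigma>)" if "prefix \<sigma> \<tau>" for \<sigma> \<tau>
      using that mono by (auto simp: prefix_def)
    show "ennreal \<epsilon> < ext_setdist d (snd (G (\<sigma> @ [False]))) (snd (G (\<sigma> @ [True])))" for \<sigma>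
      unfolding child by (rule q(3)[OF V(1,2)])
  qed
  then show ?thesis by blast
qed

theorem proposition3p17:
  fixes X :: "'a topology" and d :: "'a \<Rightarrow> 'a \<Rightarrow> ennreal"
  assumes "topometric_space X d" and "locally_compact_space X"
  shows "CB_analysable X d \<longleftrightarrow>
    \<not> (\<exists>\<epsilon>::real. \<epsilon> > 0 \<and> (\<exists>F. perfect_tree X d \<epsilon> F))"
proof -
  have "cb_kernel X d \<epsilon> \<noteq> {} \<longleftrightarrow> (\<exists>F. perfect_tree X d \<epsilon> F)" for \<epsilon>
    unfolding cb_kernel_nonempty_iff
    using fixed_set_imp_perfect_tree[OF assms] perfect_tree_imp_fixed_set by metis
  then show ?thesis unfolding CB_analysable_def by blast
qed

end
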